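(* Let $r,s,t \in \mathbb{N}$. Let $\mathcal{F}$ be a $(\leq r)$-family with $l(\mathcal{F},t) \geq c(r,s,t)\, l(\mathcal{F},t+1)$, let $\mathcal{G}$ be a $(\leq s)$-family with $l(\mathcal{G},t) \geq c(r,s,t)\, l(\mathcal{G},t+1)$, and let $\mathcal{A} \subseteq \mathcal{F}$ and $\mathcal{B} \subseteq \mathcal{G}$ be cross-$t$-intersecting families. Then $$|\mathcal{A}||\mathcal{B}| \leq l(\mathcal{F},t)\, l(\mathcal{G},t),$$ and equality holds if and only if $\mathcal{A} = \mathcal{F}(T) \in {\rm L}(\mathcal{F},t)$ and $\mathcal{B} = \mathcal{G}(T) \in {\rm L}(\mathcal{G},t)$ for some $t$-element set $T$.
   Context: All sets and families (sets of sets) are finite; $\mathbb{N}=\{1,2,\dots\}$. A set $A$ $t$-intersects a set $B$ if $|A\cap B|\geq t$. Families $\mathcal{A}$ and $\mathcal{B}$ are cross-$t$-intersecting if every set in $\mathcal{A}$ $t$-intersects every set in $\mathcal{B}$. For a family $\mathcal{F}$ and a set $T$, $\mathcal{F}(T)=\{F\in\mathcal{F}: T\subseteq F\}$; this is called a $t$-star of $\mathcal{F}$ if $|T|=t$. $l(\mathcal{F},t)$ denotes the size of a largest $t$-star of $\mathcal{F}$ (i.e. $\max_{|T|=t}|\mathcal{F}(T)|$), and ${\rm L}(\mathcal{F},t)$ denotes the set of largest $t$-stars of $\mathcal{F}$. A $(\leq r)$-family is a family each of whose sets has at most $r$ elements. The function $c:\mathbb{N}^3\to\mathbb{N}$ is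 defined by $c(r,s,t)=\max\{r\binom{s}{t}, s\binom{r}{t}\}+1$ if $t\leq \min\{r,s\}$, and $c(r,s,t)=1$ otherwise.
   Formalization: The "only if" half of the equality claim is proved only when l(F,t) > 0 and l(G,t) > 0; otherwise it fails, e.g. r=s=t=1, F={∅}, G={{1}}, A={∅}, B=∅. The inequality and the "if" half are proved in all cases. *)

theory Defs
  imports Main
begin

definition le_family :: "nat \<Rightarrow> 'a set set \<Rightarrow> bool" where
  "le_family r F \<longleftrightarrow> finite F \<and> (\<forall>X\<in>F. finite X \<and> card X \<le> r)"

definition cross_intersecting :: "nat \<Rightarrow> 'a set set \<Rightarrow> 'a set set \<Rightarrow> bool" where
  "cross_intersecting t A B \<longleftrightarrow> (\<forall>X\<in>A. \<forall>Y\<in>B. t \<le> card (X \<inter> Y))"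

definition star :: "'a set set \<Rightarrow> 'a set \<Rightarrow> 'a set set" where
  "star F T = {X \<in> F. T \<subseteq> X}"

definition stars :: "'a set set \<Rightarrow> nat \<Rightarrow> 'a set set set" where
  "stars F t = {star F T | T. finite T \<and> card T = t}"

text \<open>For a finite family the supremum is a maximum. \<^const>\<open>Sup\<close> is used rather than
  \<^const>\<open>Max\<close> because the ground type may be finite with fewer than \<open>t\<close> elements; there are
  then no \<open>t\<close>-stars, and the supremum of the empty set of naturals is \<open>0\<close>.\<close>
definition largest_star_size :: "'a set set \<Rightarrow> nat \<Rightarrow> nat" where
  "largest_star_size F t = Sup (card ` stars F t)"

definition largest_stars :: "'a set set \<Rightarrow> nat \<Rightarrow> 'a set set set" where
  "largest_stars F t = {S \<in> stars F t. card S = largest_star_size F t}"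

definition c_bound :: "nat \<Rightarrow> nat \<Rightarrow> nat \<Rightarrow> nat" where
  "c_bound r s t =
     (if t \<le> min r s then max (r * (s choose t)) (s * (r choose t)) + 1 else 1)"

end

(* Fix Y in B: every member of A contains one of the at most (s choose t) t-subsets T of Y.
   If moreover some Y' in B omits T, then the members of A containing T contain T together with a
   further point of Y', so there are at most s * l(F, t+1) of them. Unless A and B lie in the
   stars of a common t-set, at least one family thus loses a factor l(.,t) / l(.,t+1), and the
   constant c(r,s,t) exceeds the price r * (s choose t) or s * (r choose t) paid for it. *)
theory Submission
  imports Defs
begin

section \<open>Stars and their sizes\<close>

lemma card_star_le_largest_star_size:
  assumes "finite F" "finite T" "card T = t"
  shows "card (star F T) \<le> largest_star_size F t"
  unfolding largest_star_size_def
proof (rule cSup_upper)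
  show "card (star F T) \<in> card ` stars F t"
    using assms(2,3) by (auto simp: stars_def)
  \<comment> \<open>The sets \<open>T\<close> may be infinitely many, but each star is a subfamily
    of \<open>F\<close>, so the supremum runs over finitely many values.\<close>
  have "stars F t \<subseteq> Pow F"
    by (auto simp: stars_def star_def)
  with \<open>finite F\<close> show "bdd_above (card ` stars F t)"
    by (meson bdd_above_finite finite_Pow_iff finite_imageI finite_subset)
qed

lemma card_star_mono: "A \<subseteq> F \<Longrightarrow> finite F \<Longrightarrow> card (star A T) \<le> card (star F T)"
  by (rule card_mono) (auto simp: star_def)

lemma largest_star_size_pos:
  assumes "finite F" "X \<in> F" "finite X" "t \<le> card X"
  shows "0 < largest_star_size F t"
proof -
  obtain T where T: "T \<subseteq> X" "card T = t" "finite T"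
    using obtain_subset_with_card_n[OF assms(4)] by metis
  then have "X \<in> star F T"
    using assms by (simp add: star_def)
  moreover have "finite (star F T)"
    using assms by (simp add: star_def)
  ultimately have "0 < card (star F T)"
    by (auto simp: card_gt_0_iff)
  then show ?thesis
    using card_star_le_largest_star_size[OF assms(1) T(3,2)] by linarith
qed

lemma card_UN_bounded:
  assumes "finite I" "\<And>i. i \<in> I \<Longrightarrow> card (A i) \<le> m"
  shows "card (\<Union>i\<in>I. A i) \<le> card I * m"
  using card_UN_le[OF assms(1), of A] sum_bounded_above[of I "\<lambda>i. card (A i)" m] assms(2)
  by fastforce

text \<open>The stars of \<open>A\<close> at the t-subsets of \<open>Y\<close> cover
  \<open>A\<close>. The bound \<open>m\<close> stays free: it is l(F,t) when nothing more is known,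
  and s * l(F,t+1) when each such t-subset is omitted by some member of the other family.\<close>

lemma card_le_of_intersecting_set:
  assumes "finite A" "finite Y" "card Y \<le> s"
    and "\<And>X. X \<in> A \<Longrightarrow> t \<le> card (X \<inter> Y)"
    and "\<And>T. T \<subseteq> Y \<Longrightarrow> card T = t \<Longrightarrow> card (star A T) \<le> m"
  shows "card A \<le> (s choose t) * m"
proof -
  let ?I = "{T. T \<subseteq> Y \<and> card T = t}"
  have fin: "finite ?I"
    using \<open>finite Y\<close> by simp
  have "A \<subseteq> (\<Union>T\<in>?I. star A T)"
  proof
    fix X assume "X \<in> A"
    then obtain T where "T \<subseteq> X \<inter> Y" "card T = t"
      using obtain_subset_with_card_n[OF assms(4)] by metis
    then show "X \<in> (\<Union>T\<in>?I. star A T)"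
      using \<open>X \<in> A\<close> by (auto simp: star_def)
  qed
  then have "card A \<le> card (\<Union>T\<in>?I. star A T)"
    using fin \<open>finite A\<close> by (intro card_mono) (auto simp: star_def)
  also have "\<dots> \<le> card ?I * m"
    using fin assms(5) by (intro card_UN_bounded) auto
  also have "card ?I = card Y choose t"
    using n_subsets[OF \<open>finite Y\<close>] by simp
  also have "(card Y choose t) * m \<le> (s choose t) * m"
    using binomial_right_mono[OF \<open>card Y \<le> s\<close>] by simp
  finally show ?thesis .
qed

text \<open>As \<open>T\<close> is not inside \<open>Y\<close>, it meets \<open>Y\<close> in fewer
  than t points. An \<open>X\<close> in \<open>A\<close> containing \<open>T\<close> must therefore
  pick up some y in \<open>Y - T\<close>, which puts it in the (t+1)-star of \<open>F\<close> at
  \<open>insert y T\<close>; there are at most s choices of y.\<close>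

lemma card_star_le_of_not_subset:
  assumes "finite F" "A \<subseteq> F" "finite T" "card T = t" "finite Y" "card Y \<le> s"
    and "\<not> T \<subseteq> Y"
    and "\<And>X. X \<in> A \<Longrightarrow> t \<le> card (X \<inter> Y)"
  shows "card (star A T) \<le> s * largest_star_size F (t + 1)"
proof -
  have "star A T \<subseteq> (\<Union>y\<in>Y - T. star F (insert y T))"
  proof
    fix X assume X: "X \<in> star A T"
    have "card (T \<inter> Y) < t"
      using assms(3,4,7) psubset_card_mono[of T "T \<inter> Y"] by blast
    also have "t \<le> card (X \<inter> Y)"
      using X assms(8) by (simp add: star_def)
    finally have "\<not> X \<inter> Y \<subseteq> T \<inter> Y"
      using card_mono[of "T \<inter> Y" "X \<inter> Y"] \<open>finite Y\<close> by auto
    then show "X \<in> (\<Union>y\<in>Y - T. star F (insert y T))"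
      using X assms(2) by (auto simp: star_def)
  qed
  then have "card (star A T) \<le> card (\<Union>y\<in>Y - T. star F (insert y T))"
    using assms(1,5) by (intro card_mono) (auto simp: star_def)
  also have "\<dots> \<le> card (Y - T) * largest_star_size F (t + 1)"
    using assms(1,3,4,5) by (intro card_UN_bounded card_star_le_largest_star_size) auto
  also have "\<dots> \<le> s * largest_star_size F (t + 1)"
    using assms(5,6) card_mono[of Y "Y - T"] by (intro mult_le_mono1) auto
  finally show ?thesis .
qed

section \<open>Cross-intersecting pairs without a common t-set\<close>

lemma cross_intersectingD:
  "cross_intersecting t A B \<Longrightarrow> X \<in> A \<Longrightarrow> Y \<in> B \<Longrightarrow> t \<le> card (X \<inter> Y)"
  by (simp add: cross_intersecting_def)

lemma cross_intersecting_sym: "cross_intersecting t A B \<Longrightarrow> cross_intersecting t B A"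
  unfolding cross_intersecting_def by (metis Int_commute)

text \<open>Strictness comes from \<open>d < c\<close> if \<open>m\<close> is positive and from
  \<open>0 < L\<close> if \<open>m = 0\<close>. The latter occurs when no set of the family has more
  than t elements.\<close>

lemma mult_less_of_mult_le:
  fixes d m L :: nat
  assumes "d < c" "c * m \<le> L" "0 < L"
  shows "d * m < L"
proof (cases "m = 0")
  case False
  then have "d * m < c * m"
    using assms(1) by simp
  with assms(2) show ?thesis by linarith
qed (use assms(3) in simp)

text \<open>Only \<open>B\<close> loses here: \<open>A\<close> may exceed l(F,t) by the factor
  \<open>s choose t\<close>, but \<open>B\<close> shrinks to r * l(G,t+1), and \<open>c\<close>
  outweighs the product of the two factors.\<close>

lemma card_mult_less_of_star:
  assumes F: "le_family r F" and G: "le_family s G"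
    and AF: "A \<subseteq> F" and BG: "B \<subseteq> G"
    and cross: "cross_intersecting t A B"
    and "B \<noteq> {}" "finite T" "card T = t" "B \<subseteq> star G T" "\<not> A \<subseteq> star F T"
    and d: "r * (s choose t) < c"
    and bound: "c * largest_star_size G (t + 1) \<le> largest_star_size G t"
    and pos: "0 < largest_star_size F t" "0 < largest_star_size G t"
  shows "card A * card B < largest_star_size F t * largest_star_size G t"
proof -
  have fin: "finite F" "finite G" "finite A" "finite B"
    using F G AF BG finite_subset by (auto simp: le_family_def)
  obtain Y where Y: "Y \<in> B" using \<open>B \<noteq> {}\<close> by blast
  obtain X where X: "X \<in> A" "\<not> T \<subseteq> X"
    using assms(10) AF by (auto simp: star_def)
  have Y': "finite Y" "card Y \<le> s" using Y BG G by (auto simp: le_family_def)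
  have X': "finite X" "card X \<le> r" using X AF F by (auto simp: le_family_def)
  have A: "card A \<le> (s choose t) * largest_star_size F t"
  proof (rule card_le_of_intersecting_set[OF fin(3) Y'])
    show "card (star A T') \<le> largest_star_size F t" if "T' \<subseteq> Y" "card T' = t" for T'
      by (rule order_trans[OF card_star_mono[OF AF fin(1)]
        card_star_le_largest_star_size[OF fin(1) finite_subset[OF that(1) Y'(1)] that(2)]])
  qed (use cross_intersectingD[OF cross] Y in auto)
  \<comment> \<open>The member \<open>X\<close> of \<open>A\<close> that omits \<open>T\<close>
    plays the part of \<open>Y\<close>, hence the factor r. All of \<open>B\<close> lies in the star
    at \<open>T\<close>, so this bounds the whole of \<open>B\<close>.\<close>
  have "card (star B T) \<le> r * largest_star_size G (t + 1)"
    using card_star_le_of_not_subset[OF fin(2) BG assms(7,8) X' X(2)]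
      cross_intersectingD[OF cross X(1)]
    by (simp add: Int_commute)
  moreover have "star B T = B"
    using assms(9) by (auto simp: star_def)
  ultimately have "card A * card B \<le>
      ((s choose t) * largest_star_size F t) * (r * largest_star_size G (t + 1))"
    using A by (intro mult_le_mono) auto
  also have "\<dots> = largest_star_size F t * (r * (s choose t) * largest_star_size G (t + 1))"
    by (simp add: algebra_simps)
  also have "\<dots> < largest_star_size F t * largest_star_size G t"
    using mult_less_of_mult_le[OF d bound pos(2)] pos(1) by simp
  finally show ?thesis .
qed

text \<open>Each t-subset of a fixed \<open>Y\<close> in \<open>B\<close> is omitted by another
  member of \<open>B\<close>, so every star in the cover of \<open>A\<close> is small.\<close>

lemma card_le_of_no_common_subset:
  assumes F: "le_family r F" and G: "le_family s G"
    and AF: "A \<subseteq> F" and BG: "B \<subseteq> G"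
    and cross: "cross_intersecting t A B"
    and "B \<noteq> {}"
    and none: "\<And>T. finite T \<Longrightarrow> card T = t \<Longrightarrow> \<not> B \<subseteq> star G T"
  shows "card A \<le> (s choose t) * (s * largest_star_size F (t + 1))"
proof -
  have fin: "finite F" "finite A"
    using F AF finite_subset by (auto simp: le_family_def)
  have B: "finite Y \<and> card Y \<le> s" if "Y \<in> B" for Y
    using that BG G by (auto simp: le_family_def)
  obtain Y where Y: "Y \<in> B" using \<open>B \<noteq> {}\<close> by blast
  show ?thesis
  proof (rule card_le_of_intersecting_set[OF fin(2), of Y])
    fix T assume T: "T \<subseteq> Y" "card T = t"
    have fT: "finite T"
      using T(1) B[OF Y] finite_subset by blast
    then obtain Y' where Y': "Y' \<in> B" "\<not> T \<subseteq> Y'"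
      using none[OF fT T(2)] BG by (auto simp: star_def)
    show "card (star A T) \<le> s * largest_star_size F (t + 1)"
      by (rule card_star_le_of_not_subset[OF fin(1) AF fT T(2) _ _ Y'(2)])
        (use B[OF Y'(1)] cross_intersectingD[OF cross _ Y'(1)] in auto)
  qed (use B cross_intersectingD[OF cross] Y in auto)
qed

lemma card_mult_less_of_no_common_star:
  assumes F: "le_family r F" and G: "le_family s G"
    and AF: "A \<subseteq> F" and BG: "B \<subseteq> G"
    and cross: "cross_intersecting t A B"
    and ne: "A \<noteq> {}" "B \<noteq> {}"
    and none: "\<And>T. finite T \<Longrightarrow> card T = t \<Longrightarrow> \<not> (A \<subseteq> star F T \<and> B \<subseteq> star G T)"
    and c: "r * (s choose t) < c" "s * (r choose t) < c"
    and boundF: "c * largest_star_size F (t + 1) \<le> largest_star_size F t"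
    and boundG: "c * largest_star_size G (t + 1) \<le> largest_star_size G t"
    and pos: "0 < largest_star_size F t" "0 < largest_star_size G t"
  shows "card A * card B < largest_star_size F t * largest_star_size G t"
proof -
  note cross' = cross_intersecting_sym[OF cross]
  \<comment> \<open>If one family lies in a t-star, the other leaves the star at that t-set and the
    one-sided estimate applies, with the roles swapped if need be. Otherwise both families
    lose.\<close>
  consider T where "finite T" "card T = t" "B \<subseteq> star G T"
    | T where "finite T" "card T = t" "A \<subseteq> star F T"
    | "\<And>T. finite T \<Longrightarrow> card T = t \<Longrightarrow> \<not> A \<subseteq> star F T \<and> \<not> B \<subseteq> star G T"
    by metis
  then show ?thesis
  proof cases
    case 1
    then have not_sub: "\<not> A \<subseteq> star F T" using none by blast
    show ?thesis
      by (rule card_mult_less_of_star[OF F G AF BG cross ne(2) 1 not_sub c(1) boundG pos])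
  next
    case 2
    then have not_sub: "\<not> B \<subseteq> star G T" using none by blast
    have "card B * card A < largest_star_size G t * largest_star_size F t"
      by (rule card_mult_less_of_star[OF G F BG AF cross' ne(1) 2 not_sub c(2) boundF pos(2,1)])
    then show ?thesis by (simp add: mult.commute)
  next
    case 3
    have "card A * card B \<le> ((s choose t) * (s * largest_star_size F (t + 1))) *
        ((r choose t) * (r * largest_star_size G (t + 1)))"
      by (intro mult_le_mono card_le_of_no_common_subset[OF F G AF BG cross ne(2)]
          card_le_of_no_common_subset[OF G F BG AF cross' ne(1)]) (simp_all add: 3)
    \<comment> \<open>The coefficients s * (s choose t) and r * (r choose t) need not lie below
      \<open>c\<close>. Exchanging the two binomials leaves coefficients that do.\<close>
    also have "\<dots> = (s * (r choose t) * largest_star_size F (t + 1)) *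
        (r * (s choose t) * largest_star_size G (t + 1))"
      by (simp add: algebra_simps)
    also have "\<dots> < largest_star_size F t * largest_star_size G t"
      using mult_less_of_mult_le[OF c(2) boundF pos(1)]
        mult_less_of_mult_le[OF c(1) boundG pos(2)]
      by (intro mult_strict_mono') auto
    finally show ?thesis .
  qed
qed

section \<open>The bound and the case of equality\<close>

lemma eq_of_mult_eq_of_le:
  fixes a b x y :: nat
  assumes "a * b = x * y" "a \<le> x" "b \<le> y" "0 < x" "0 < y"
  shows "a = x \<and> b = y"
proof (rule ccontr)
  assume "\<not> (a = x \<and> b = y)"
  with assms(2,3) consider "a < x" | "b < y" by linarith
  then have "a * b < x * y"
  proof cases
    case 1
    then have "a * y < x * y" using assms(5) by simp
    then show ?thesis using mult_le_mono2[OF assms(3), of a] by linarith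
  next
    case 2
    then have "x * b < x * y" using assms(4) by simp
    then show ?thesis using mult_le_mono1[OF assms(2), of b] by linarith
  qed
  with assms(1) show False by simp
qed

text \<open>The forward direction of the equivalence is claimed for positive star sizes only: if one
  of them is 0, then \<open>A = {}\<close> with any \<open>B\<close> attains the bound 0, whether or
  not \<open>B\<close> is a largest star. The converse is stated without this restriction.\<close>

theorem theorem1p2:
  fixes r s t :: nat
    and F G A B :: "'a set set"
  assumes "1 \<le> r" and "1 \<le> s" and "1 \<le> t"
    and "le_family r F"
    and "largest_star_size F t \<ge> c_bound r s t * largest_star_size F (t + 1)"
    and "le_family s G"
    and "largest_star_size G t \<ge> c_bound r s t * largest_star_size G (t + 1)"
    and "A \<subseteq> F" and "B \<subseteq> G"
    and "cross_intersecting t A B"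
  shows "card A * card B \<le> largest_star_size F t * largest_star_size G t \<and>
    (0 < largest_star_size F t \<and> 0 < largest_star_size G t \<longrightarrow>
      (card A * card B = largest_star_size F t * largest_star_size G t \<longleftrightarrow>
       (\<exists>T. finite T \<and> card T = t \<and>
          A = star F T \<and> star F T \<in> largest_stars F t \<and>
          B = star G T \<and> star G T \<in> largest_stars G t))) \<and>
    ((\<exists>T. finite T \<and> card T = t \<and>
          A = star F T \<and> star F T \<in> largest_stars F t \<and>
          B = star G T \<and> star G T \<in> largest_stars G t) \<longrightarrow>
      card A * card B = largest_star_size F t * largest_star_size G t)"
proof -
  let ?lF = "largest_star_size F t" and ?lG = "largest_star_size G t"
  let ?P = "\<lambda>T. finite T \<and> card T = t \<and> A = star F T \<and> star F T \<in> largest_stars F t \<and>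
    B = star G T \<and> star G T \<in> largest_stars G t"
  have fin: "finite F" "finite G"
    using assms(4,6) by (auto simp: le_family_def)
  have attained: "card A * card B = ?lF * ?lG" if "\<exists>T. ?P T"
    using that by (auto simp: largest_stars_def)
  have le_and_eq: "card A * card B \<le> ?lF * ?lG \<and>
      (0 < ?lF \<longrightarrow> 0 < ?lG \<longrightarrow> card A * card B = ?lF * ?lG \<longrightarrow> (\<exists>T. ?P T))"
  proof (cases "A = {} \<or> B = {}")
    \<comment> \<open>The product is 0, so equality contradicts the positivity of both star
      sizes.\<close>
    case True
    then show ?thesis by auto
  next
    case False
    then obtain X Y where XY: "X \<in> A" "Y \<in> B" by blast
    have X: "X \<in> F" "finite X" "card X \<le> r" and Y: "Y \<in> G" "finite Y" "card Y \<le> s"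
      using XY assms(4,6,8,9) by (auto simp: le_family_def)
    have t: "t \<le> card X" "t \<le> card Y"
      using cross_intersectingD[OF assms(10) XY] card_mono[of X "X \<inter> Y"] card_mono[of Y "X \<inter> Y"] X Y by auto
    have pos: "0 < ?lF" "0 < ?lG"
      using largest_star_size_pos[OF fin(1) X(1,2) t(1)]
        largest_star_size_pos[OF fin(2) Y(1,2) t(2)] by simp_all
    \<comment> \<open>\<open>X\<close> and \<open>Y\<close> share t points, so t is at most
      \<open>min r s\<close> and \<open>c_bound\<close> takes its first branch, where the
      \<open>+ 1\<close> gives strictness.\<close>
    have c: "r * (s choose t) < c_bound r s t" "s * (r choose t) < c_bound r s t"
      using t X(3) Y(3) by (auto simp: c_bound_def)
    show ?thesis
    proof (cases "\<exists>T. finite T \<and> card T = t \<and> A \<subseteq> star F T \<and> B \<subseteq> star G T")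
      case True
      then obtain T where T: "finite T" "card T = t" "A \<subseteq> star F T" "B \<subseteq> star G T" by blast
      have finS: "finite (star F T)" "finite (star G T)"
        using fin by (auto simp: star_def)
      have A: "card A \<le> card (star F T)" "card (star F T) \<le> ?lF"
        and B: "card B \<le> card (star G T)" "card (star G T) \<le> ?lG"
        using card_mono[OF finS(1) T(3)] card_mono[OF finS(2) T(4)]
          card_star_le_largest_star_size[OF fin(1) T(1,2)]
          card_star_le_largest_star_size[OF fin(2) T(1,2)] by simp_all
      have "?P T" if "card A * card B = ?lF * ?lG"
      proof -
        have "card A = ?lF \<and> card B = ?lG"
          by (rule eq_of_mult_eq_of_le[OF that]) (use A B pos in linarith)+
        \<comment> \<open>The chain from \<open>card A\<close> through
          \<open>card (star F T)\<close> to \<open>?lF\<close> collapses, and likewise for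
          \<open>B\<close>: each family fills its star, and that star is a largest one.\<close>
        then have "card A = card (star F T)" "card (star F T) = ?lF"
          "card B = card (star G T)" "card (star G T) = ?lG"
          using A B by linarith+
        moreover from this have "A = star F T" "B = star G T"
          using T finS card_subset_eq by metis+
        ultimately show ?thesis
          using T by (auto simp: largest_stars_def stars_def)
      qed
      moreover have "card A * card B \<le> ?lF * ?lG"
        using A B by (intro mult_le_mono) linarith+
      ultimately show ?thesis by blast
    next
      case no_common: False
      have "card A * card B < ?lF * ?lG"
        by (rule card_mult_less_of_no_common_star[OF assms(4,6,8,9,10) _ _ _ c assms(5,7) pos])
          (use no_common False in auto)
      then show ?thesis by simp
    qed
  qed
  show ?thesis
    using le_and_eq attained by blast
qed

end
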